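(* Let $v$ be any solution of $$(r^{n-k}(v')^k)'+r^{n-1}\big(rv'+\kappa v+c_{n,k}^{-1}|v|^{q-1}v\big)=0\quad\text{in }(0,\infty)$$ such that $L=\lim_{r\to\infty}r^{\kappa}v(r)>0$. Then $$\lim_{r\to\infty}r^{\kappa+1}v'(r)=-\kappa L,$$ and, as $r\to\infty$, $$v(r)=\begin{cases} r^{-\kappa}\Big(L+(A+o(1))\left(\frac{2k}{k+1}\right)^{\frac{(k+1)(\kappa+2)}{2}}r^{-\nu}\Big),&\text{if }(q-k)\kappa>2k,\\ r^{-\kappa}\Big(L+(A+B+o(1))\left(\frac{2k}{k+1}\right)^{\frac{(k+1)\kappa q}{2k}}r^{-\kappa(q-1)}\Big),&\text{if }(q-k)\kappa=2k,\\ r^{-\kappa}\Big(L+(B+o(1))\left(\frac{2k}{k+1}\right)^{\frac{(k+1)\kappa q}{2k}}r^{-\kappa(q-1)}\Big),&\text{if }(q-k)\kappa<2k, \end{cases}$$ where $$\nu=(k-1)\kappa+2k,\quad A=\frac{(k\kappa-(n-2k))\left(\frac{k+1}{2k}\right)^{\frac{(k+1)(\kappa+2)}{2}}(\kappa L)^k}{\nu},\quad B=\frac{\left(\frac{k+1}{2k}\right)^{\frac{(k+1)\kappa q}{2k}}L^q}{\kappa(q-1)c_{n,k}} .$$ Moreover, an asymptotic expansion of $v'$ is obtained by differentiating these expansions term by term; that is, as $r\to\infty$, $$v'(r)=\begin{cases} -r^{-\kappa-1}\Big(\kappa L+(\kappa+\nu)(A+o(1))\left(\frac{2k}{k+1}\right)^{\frac{(k+1)(\kappa+2)}{2}}r^{-\nu}\Big),&\text{if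 }(q-k)\kappa>2k,\\ -r^{-\kappa-1}\Big(\kappa L+\kappa q(A+B+o(1))\left(\frac{2k}{k+1}\right)^{\frac{(k+1)\kappa q}{2k}}r^{-\kappa(q-1)}\Big),&\text{if }(q-k)\kappa=2k,\\ -r^{-\kappa-1}\Big(\kappa L+\kappa q(B+o(1))\left(\frac{2k}{k+1}\right)^{\frac{(k+1)\kappa q}{2k}}r^{-\kappa(q-1)}\Big),&\text{if }(q-k)\kappa<2k. \end{cases}$$
   Context: Here $n>2$ and $1\le k\le n$ are integers with $k$ odd, $q>k$ and $\kappa>0$ are real, and $c_{n,k}=\frac1n\binom nk$. A solution of the equation is a function $v\in C^1((0,\infty))$ with $r^{n-k}(v')^k\in C^1((0,\infty))$ satisfying the equation pointwise. *)

theory Defs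
  imports "HOL-Analysis.Analysis" "HOL-Library.Landau_Symbols"
begin

definition c_nk :: "nat \<Rightarrow> nat \<Rightarrow> real" where
  "c_nk n k = 1 / real n * real (n choose k)"

text \<open>Only the values of \<open>v\<close> on \<open>{0<..}\<close> matter: this set is open, so \<open>deriv v r\<close> at
  \<open>r > 0\<close> does not see \<open>v\<close> elsewhere.\<close>

definition is_solution :: "nat \<Rightarrow> nat \<Rightarrow> real \<Rightarrow> real \<Rightarrow> (real \<Rightarrow> real) \<Rightarrow> bool" where
  "is_solution n k q \<kappa> v \<longleftrightarrow>
     v C1_differentiable_on {0<..} \<and>
     (\<lambda>r. r ^ (n - k) * (deriv v r) ^ k) C1_differentiable_on {0<..} \<and>
     (\<forall>r>0. deriv (\<lambda>s. s ^ (n - k) * (deriv v s) ^ k) r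
        + r ^ (n - 1) * (r * deriv v r + \<kappa> * v r
            + inverse (c_nk n k) * \<bar>v r\<bar> powr (q - 1) * v r) = 0)"

definition nu :: "nat \<Rightarrow> real \<Rightarrow> real" where
  "nu k \<kappa> = (real k - 1) * \<kappa> + 2 * real k"

definition coeff_A :: "nat \<Rightarrow> nat \<Rightarrow> real \<Rightarrow> real \<Rightarrow> real" where
  "coeff_A n k \<kappa> L =
     (real k * \<kappa> - (real n - 2 * real k))
       * ((real k + 1) / (2 * real k)) powr ((real k + 1) * (\<kappa> + 2) / 2)
       * (\<kappa> * L) ^ k / nu k \<kappa>"

definition coeff_B :: "nat \<Rightarrow> nat \<Rightarrow> real \<Rightarrow> real \<Rightarrow> real \<Rightarrow> real" where
  "coeff_B n k q \<kappa> L =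
     ((real k + 1) / (2 * real k)) powr ((real k + 1) * \<kappa> * q / (2 * real k))
       * L powr q / (\<kappa> * (q - 1) * c_nk n k)"

end

theory Submission imports Defs begin

text \<open>Put \<open>z = r\<^sup>\<kappa> v\<close>, \<open>y = r\<^sup>\<kappa>\<^sup>+\<^sup>1 v'\<close> and \<open>a = n - 2k - k\<kappa>\<close>. The equation becomes
  \<open>r z' = \<kappa> z + y\<close>, \<open>r (y\<^sup>k)' = - a y\<^sup>k - r\<^sup>\<nu> (\<kappa> z + y + g)\<close> with
  \<open>g = r\<^sup>-\<^sup>\<kappa>\<^sup>(\<^sup>q\<^sup>-\<^sup>1\<^sup>) |z|\<^sup>q\<^sup>-\<^sup>1 z / c\<close>: a fast variable \<open>y\<close> relaxing to the curve \<open>y = - \<kappa> z\<close>.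
  The known limit of \<open>z\<close> prevents \<open>p = r\<^sup>\<mu> (\<kappa> z + y) = r\<^sup>\<mu>\<^sup>+\<^sup>1 z'\<close> from staying on the wrong side of
  its expected limit, and the large factor \<open>r\<^sup>\<nu>\<close> prevents it from crossing back. With \<open>\<mu> = 0\<close> this
  gives the limit of \<open>y\<close>; integrating the equation then gives the second term of \<open>z\<close>, and the
  same argument with \<open>\<mu> = min(\<nu>, \<kappa>(q-1))\<close> gives the second term of \<open>y\<close>.\<close>

section \<open>Barrier argument and tail estimates near infinity\<close>

text \<open>At the first zero after a point with \<open>F < 0\<close>, \<open>F\<close> arrives from
  negative values, so its derivative there cannot be negative. Controlling \<open>F'\<close> on the
  zeros of \<open>F\<close> is therefore enough for one late negative value to trap \<open>F\<close>
  below zero.\<close>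

lemma eventually_negative_if_frequently_negative:
  fixes F F' :: "real \<Rightarrow> real"
  assumes freq: "\<exists>\<^sub>F r in at_top. F r < 0"
    and deriv: "\<forall>\<^sub>F r in at_top. (F has_real_derivative F' r) (at r)"
    and inward: "\<forall>\<^sub>F r in at_top. F r = 0 \<longrightarrow> F' r < 0"
  shows "\<forall>\<^sub>F r in at_top. F r < 0"
proof -
  obtain R where D: "\<And>r. R \<le> r \<Longrightarrow> (F has_real_derivative F' r) (at r)"
    and N: "\<And>r. R \<le> r \<Longrightarrow> F r = 0 \<Longrightarrow> F' r < 0"
    using eventually_conj[OF deriv inward] unfolding eventually_at_top_linorder by blast
  obtain r0 where r0: "R \<le> r0" "F r0 < 0"
    using freq unfolding frequently_def eventually_at_top_linorder by metis
  have "F r1 < 0" if "r0 \<le> r1" for r1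
  proof (rule ccontr)
    assume "\<not> F r1 < 0"
    have cont: "continuous_on {r0..r1} F"
      using D r0(1) by (intro DERIV_continuous_on[of _ F F']) (auto intro: has_field_derivative_at_within)
    \<comment> \<open>\<open>S\<close> turns out compact and nonempty, so it has a least element
      \<open>s\<close>: the first point from \<open>r0\<close> on at which \<open>F\<close> is no
      longer negative.\<close>
    define S where "S = {r \<in> {r0..r1}. F r \<in> {0..}}"
    have "S = {r0..r1} \<inter> F -` {0..}" by (auto simp: S_def)
    then have "closed S" using continuous_closed_preimage[OF cont] by simp
    then have "compact S"
      by (auto simp: compact_eq_bounded_closed S_def intro: bounded_subset[OF bounded_closed_interval])
    moreover have "r1 \<in> S" using that \<open>\<not> F r1 < 0\<close> by (auto simp: S_def)
    ultimately obtain s where s: "s \<in> S" and min: "\<And>t. t \<in> S \<Longrightarrow> s \<le> t"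
      using compact_attains_inf[of S] by blast
    have below: "F t < 0" if "r0 \<le> t" "t < s" for t
      using min[of t] s that by (force simp: S_def)
    have "r0 < s" using s r0 by (auto simp: S_def order.order_iff_strict)
    have "F s \<le> 0"
    proof (rule tendsto_upperbound)
      have "(F \<longlongrightarrow> F s) (at s)"
        using D[of s] s r0(1) by (simp add: DERIV_isCont S_def flip: isCont_def)
      then show "(F \<longlongrightarrow> F s) (at_left s)" by (rule filterlim_at_split[THEN iffD1, THEN conjunct1])
      show "\<forall>\<^sub>F t in at_left s. F t \<le> 0"
        using eventually_at_left_real[OF \<open>r0 < s\<close>] below by (auto elim!: eventually_mono intro: less_imp_le)
    qed simp
    then have "F s = 0" "R \<le> s" using s r0(1) by (auto simp: S_def)
    then obtain d where d: "d > 0" "\<And>h. 0 < h \<Longrightarrow> h < d \<Longrightarrow> F s < F (s - h)"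
      using DERIV_neg_dec_left[OF D N] by blast
    define h where "h = min (d / 2) (s - r0)"
    have "0 < h" "h < d" "r0 \<le> s - h" using d(1) \<open>r0 < s\<close> by (auto simp: h_def)
    then show False using d(2)[of h] below[of "s - h"] \<open>F s = 0\<close> by simp
  qed
  then show ?thesis unfolding eventually_at_top_linorder by blast
qed

text \<open>For \<open>\<mu> > 0\<close>, integrate the lower bound on \<open>u'\<close> from
  \<open>r\<close> to infinity. The factor \<open>\<mu>\<close> is kept on the left so that
  \<open>\<mu> = 0\<close> makes sense too: the claim is then \<open>M \<le> 0\<close>, because a
  positive \<open>M\<close> would force \<open>u\<close> to grow logarithmically.\<close>

lemma tail_bound_of_derivative_bound:
  fixes u u' :: "real \<Rightarrow> real" and M \<mu> l :: real
  assumes lim: "(u \<longlongrightarrow> l) at_top" and "0 \<le> \<mu>"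
    and deriv: "\<forall>\<^sub>F r in at_top. (u has_real_derivative u' r) (at r)"
    and bound: "\<forall>\<^sub>F r in at_top. M * r powr (- \<mu> - 1) \<le> u' r"
  shows "\<forall>\<^sub>F r in at_top. \<mu> * (r powr \<mu> * (u r - l)) \<le> - M"
proof -
  obtain R0 where R0: "\<And>r. R0 \<le> r \<Longrightarrow> (u has_real_derivative u' r) (at r)"
      "\<And>r. R0 \<le> r \<Longrightarrow> M * r powr (- \<mu> - 1) \<le> u' r"
    using eventually_conj[OF deriv bound] unfolding eventually_at_top_linorder by blast
  define R where "R = max R0 1"
  have R: "1 \<le> R" "\<And>r. R \<le> r \<Longrightarrow> (u has_real_derivative u' r) (at r)"
      "\<And>r. R \<le> r \<Longrightarrow> M * r powr (- \<mu> - 1) \<le> u' r"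
    using R0 by (auto simp: R_def)
  show ?thesis
  proof (cases "\<mu> = 0")
    case True
    have "M \<le> 0"
    proof (rule ccontr)
      assume "\<not> M \<le> 0"
      have mono: "u R - M * ln R \<le> u r - M * ln r" if "R \<le> r" for r
      proof (rule DERIV_nonneg_imp_nondecreasing[OF that])
        fix x assume "R \<le> x" "x \<le> r"
        then have "((\<lambda>r. u r - M * ln r) has_real_derivative u' x - M / x) (at x)"
          using R by (auto intro!: derivative_eq_intros)
        moreover have "0 \<le> u' x - M / x"
          using R(1) R(3)[OF \<open>R \<le> x\<close>] \<open>R \<le> x\<close> True by (simp add: powr_minus_divide)
        ultimately show "\<exists>y. ((\<lambda>r. u r - M * ln r) has_real_derivative y) (at x) \<and> 0 \<le> y"
          by blast
      qed
      have "filterlim (\<lambda>r. (u R - M * ln R) + M * ln r) at_top at_top"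
        using \<open>\<not> M \<le> 0\<close>
        by (intro filterlim_tendsto_add_at_top[OF tendsto_const]
            filterlim_tendsto_pos_mult_at_top[OF tendsto_const _ ln_at_top]) auto
      then have "filterlim u at_top at_top"
        by (rule filterlim_at_top_mono)
          (use mono in \<open>auto simp: eventually_at_top_linorder algebra_simps intro!: exI[of _ R]\<close>)
      then show False
        using lim not_tendsto_and_filterlim_at_infinity[OF trivial_limit_at_top_linorder]
          filterlim_at_top_imp_at_infinity by blast
    qed
    then show ?thesis using True by simp
  next
    case False
    then have "\<mu> > 0" using \<open>0 \<le> \<mu>\<close> by simp
    \<comment> \<open>The added term has derivative \<open>- M * r powr (- \<mu> - 1)\<close> and
      vanishes at infinity, so \<open>w\<close> is eventually nondecreasing with limit
      \<open>l\<close>, hence at most \<open>l\<close>.\<close>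
    define w where "w = (\<lambda>r. u r + M / \<mu> * r powr - \<mu>)"
    have mono: "w s \<le> w r" if "R \<le> s" "s \<le> r" for s r
    proof (rule DERIV_nonneg_imp_nondecreasing[OF that(2)])
      fix x assume x: "s \<le> x" "x \<le> r"
      then have "(w has_real_derivative u' x - M * x powr (- \<mu> - 1)) (at x)"
        unfolding w_def using R that \<open>\<mu> > 0\<close> by (auto intro!: derivative_eq_intros)
      moreover have "0 \<le> u' x - M * x powr (- \<mu> - 1)"
        using R(3)[of x] x that by simp
      ultimately show "\<exists>y. (w has_real_derivative y) (at x) \<and> 0 \<le> y" by blast
    qed
    have "(w \<longlongrightarrow> l + M / \<mu> * 0) at_top"
      unfolding w_def using \<open>\<mu> > 0\<close>
      by (intro tendsto_intros lim tendsto_neg_powr filterlim_ident) auto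
    then have wl: "w s \<le> l" if "R \<le> s" for s
      using that mono
      by (intro tendsto_lowerbound[of w l]) (auto simp: eventually_at_top_linorder intro!: exI[of _ s])
    have "\<mu> * (s powr \<mu> * (u s - l)) \<le> - M" if "R \<le> s" for s
    proof -
      have "(\<mu> * s powr \<mu>) * w s \<le> (\<mu> * s powr \<mu>) * l"
        using wl[OF that] \<open>\<mu> > 0\<close> by (intro mult_left_mono) auto
      moreover have "(\<mu> * s powr \<mu>) * w s = \<mu> * s powr \<mu> * u s + M"
        using \<open>\<mu> > 0\<close> R(1) that by (simp add: w_def powr_minus field_simps)
      ultimately show ?thesis by (simp add: algebra_simps)
    qed
    then show ?thesis unfolding eventually_at_top_linorder by blast
  qed
qed

text \<open>Including \<open>s = 0\<close> lets the borderline cases \<open>\<mu> = 0\<close> and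
  \<open>\<mu> = \<nu>\<close> run through the same limits as the strict ones.\<close>

lemma tendsto_powr_at_top_nonpos:
  fixes s :: real
  assumes "s \<le> 0"
  shows "((\<lambda>r. r powr s) \<longlongrightarrow> (if s = 0 then 1 else 0)) at_top"
proof (cases "s = 0")
  case True
  have "\<forall>\<^sub>F r in at_top. r powr s = 1"
    using eventually_gt_at_top[of 0] by eventually_elim (simp add: True)
  then show ?thesis using True by (auto intro: tendsto_eventually)
qed (use assms in \<open>auto intro!: tendsto_neg_powr filterlim_ident\<close>)

lemma power_less_iff_odd:
  fixes x y :: "'a::linordered_idom"
  assumes "odd n"
  shows "x ^ n < y ^ n \<longleftrightarrow> x < y"
proof -
  have "x ^ n < y ^ n" if "x < y" for x y :: 'a
  proof (cases "0 \<le> x")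
    case True
    then show ?thesis using that assms by (auto intro: power_strict_mono simp: odd_pos)
  next
    case neg: False
    show ?thesis
    proof (cases "y \<le> 0")
      case True
      then have "(- y) ^ n < (- x) ^ n"
        using that assms by (intro power_strict_mono) (auto simp: odd_pos)
      then show ?thesis using assms by simp
    next
      case False
      then have "x ^ n < 0" "0 < y ^ n" using neg assms by auto
      then show ?thesis by order
    qed
  qed
  then show ?thesis by (metis linorder_less_linear order_less_asym)
qed

text \<open>The limit squeezes \<open>u'\<close> between multiples of
  \<open>r powr (- \<mu> - 1)\<close> with constants close to \<open>c\<close>. The one-sided tail
  bound, applied to \<open>u\<close> and to \<open>- u\<close>, gives the two halves.\<close>

lemma tail_expansion_of_derivative_limit:
  fixes u u' :: "real \<Rightarrow> real" and c \<mu> l :: real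
  assumes lim: "(u \<longlongrightarrow> l) at_top" and "0 < \<mu>"
    and deriv: "\<forall>\<^sub>F r in at_top. (u has_real_derivative u' r) (at r)"
    and lim': "((\<lambda>r. r powr (\<mu> + 1) * u' r) \<longlongrightarrow> c) at_top"
  shows "((\<lambda>r. r powr \<mu> * (u r - l)) \<longlongrightarrow> - c / \<mu>) at_top"
proof -
  have upper: "\<forall>\<^sub>F r in at_top. \<mu> * (r powr \<mu> * (u r - l)) < b"
    if "(u \<longlongrightarrow> l) at_top" "\<forall>\<^sub>F r in at_top. (u has_real_derivative u' r) (at r)"
      "((\<lambda>r. r powr (\<mu> + 1) * u' r) \<longlongrightarrow> c) at_top" "- c < b"
    for u u' :: "real \<Rightarrow> real" and c l b
  proof -
    \<comment> \<open>The midpoint of \<open>- b\<close> and \<open>c\<close>, which lies strictly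
      between them.\<close>
    define M where "M = (c - b) / 2"
    have M: "M < c" "- M < b" using that(4) by (auto simp: M_def field_simps)
    have "\<forall>\<^sub>F r in at_top. M * r powr (- \<mu> - 1) \<le> u' r"
      using order_tendstoD(1)[OF that(3) M(1)] eventually_gt_at_top[of 0]
    proof eventually_elim
      case (elim r)
      then show ?case by (simp add: powr_diff powr_minus powr_add field_simps)
    qed
    from tail_bound_of_derivative_bound[OF that(1) _ that(2) this] \<open>0 < \<mu>\<close> M(2)
    show ?thesis by (auto elim!: eventually_mono)
  qed
  have "((\<lambda>r. \<mu> * (r powr \<mu> * (u r - l))) \<longlongrightarrow> - c) at_top"
  proof (rule order_tendstoI)
    fix b assume "- c < b"
    then show "\<forall>\<^sub>F r in at_top. \<mu> * (r powr \<mu> * (u r - l)) < b"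
      using upper[OF lim deriv lim'] by blast
  next
    fix b assume "b < - c"
    have "\<forall>\<^sub>F r in at_top. ((\<lambda>r. - u r) has_real_derivative - u' r) (at r)"
      using deriv by (auto elim!: eventually_mono intro: DERIV_minus)
    moreover have "((\<lambda>r. r powr (\<mu> + 1) * - u' r) \<longlongrightarrow> - c) at_top"
      using tendsto_minus[OF lim'] by simp
    ultimately have "\<forall>\<^sub>F r in at_top. \<mu> * (r powr \<mu> * (- u r - - l)) < - b"
      using upper[OF tendsto_minus[OF lim], of "\<lambda>r. - u' r" "- c" "- b"] \<open>b < - c\<close> by simp
    then show "\<forall>\<^sub>F r in at_top. b < \<mu> * (r powr \<mu> * (u r - l))"
      by eventually_elim (simp add: algebra_simps)
  qed
  from tendsto_divide[OF this tendsto_const, of \<mu>] show ?thesis using \<open>0 < \<mu>\<close> by simp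
qed

section \<open>Limits and expansions for the relaxing system\<close>

text \<open>The sign of \<open>L\<close> and the shape of \<open>g\<close> are left open, so that
  the system can be negated and each upper bound also yields a lower bound.\<close>

locale relaxing_system =
  fixes k :: nat and \<kappa> \<nu> a L :: real and z y g :: "real \<Rightarrow> real"
  assumes odd_k: "odd k" and nu_pos: "0 < \<nu>"
    and z_deriv: "\<And>r. 0 < r \<Longrightarrow> (z has_real_derivative (\<kappa> * z r + y r) / r) (at r)"
    and y_deriv: "\<And>r. 0 < r \<Longrightarrow> ((\<lambda>r. y r ^ k) has_real_derivative
        - (a * y r ^ k + r powr \<nu> * (\<kappa> * z r + y r + g r)) / r) (at r)"
    and z_lim: "(z \<longlongrightarrow> L) at_top"
begin

text \<open>Comparing \<open>y\<^sup>k\<close>, rather than \<open>y\<close>, with the \<open>k\<close>-th power of the curve \<open>\<kappa> z + y = M r\<^sup>-\<^sup>\<mu>\<close> avoids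
  differentiating \<open>y\<close>, which need not be differentiable where it vanishes.\<close>

lemma slope_eventually_less:
  fixes \<mu> G M E :: real
  assumes "0 \<le> \<mu>" "\<mu> \<le> \<nu>"
    and g_lim: "((\<lambda>r. r powr \<mu> * g r) \<longlongrightarrow> G) at_top"
    and E: "E = G + (if \<mu> = \<nu> then a * (- \<kappa> * L) ^ k else 0)"
    and tail: "((\<lambda>r. \<mu> * (r powr \<mu> * (z r - L))) \<longlongrightarrow> E) at_top"
    and "- E < M"
  shows "\<forall>\<^sub>F r in at_top. r powr \<mu> * (\<kappa> * z r + y r) < M"
proof -
  \<comment> \<open>\<open>\<gamma> r\<close> is the value of \<open>y r\<close> at which the scaled
    slope \<open>r powr \<mu> * (\<kappa> * z r + y r)\<close> equals \<open>M\<close>.\<close>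
  define \<gamma> where "\<gamma> = (\<lambda>r. M * r powr - \<mu> - \<kappa> * z r)"
  define F where "F = (\<lambda>r. y r ^ k - \<gamma> r ^ k)"
  define \<gamma>' where "\<gamma>' = (\<lambda>r. - (\<mu> * M * r powr - \<mu> + \<kappa> * (\<kappa> * z r + y r)) / r)"
  define F' where "F' = (\<lambda>r. - (a * y r ^ k + r powr \<nu> * (\<kappa> * z r + y r + g r)) / r
      - real k * \<gamma>' r * \<gamma> r ^ (k - 1))"
  have gap: "y r < \<gamma> r \<longleftrightarrow> r powr \<mu> * (\<kappa> * z r + y r) < M"
      "y r = \<gamma> r \<longleftrightarrow> r powr \<mu> * (\<kappa> * z r + y r) = M" if "0 < r" for r
    using that by (auto simp: \<gamma>_def powr_minus field_simps)
  have F_neg: "F r < 0 \<longleftrightarrow> y r < \<gamma> r" for r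
    using power_less_iff_odd[OF odd_k] by (simp add: F_def)
  have F_zero: "y r = \<gamma> r" if "F r = 0" for r
    using that power_less_iff_odd[OF odd_k, of "y r" "\<gamma> r"] power_less_iff_odd[OF odd_k, of "\<gamma> r" "y r"]
    by (simp add: F_def)
  \<comment> \<open>If the slope stayed at or above \<open>M\<close>, integrating \<open>z'\<close>
    would give \<open>E \<le> - M\<close> through the assumed limit \<open>tail\<close>.\<close>
  have "\<exists>\<^sub>F r in at_top. r powr \<mu> * (\<kappa> * z r + y r) < M"
  proof (rule ccontr)
    assume "\<not> ?thesis"
    then have "\<forall>\<^sub>F r in at_top. M \<le> r powr \<mu> * (\<kappa> * z r + y r)"
      by (simp add: frequently_def not_less)
    then have "\<forall>\<^sub>F r in at_top. M * r powr (- \<mu> - 1) \<le> (\<kappa> * z r + y r) / r"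
      using eventually_gt_at_top[of 0]
    proof eventually_elim
      case (elim r)
      then show ?case by (simp add: powr_diff powr_minus field_simps)
    qed
    moreover have "\<forall>\<^sub>F r in at_top. (z has_real_derivative (\<kappa> * z r + y r) / r) (at r)"
      using eventually_gt_at_top[of 0] by (rule eventually_mono) (rule z_deriv)
    ultimately have "\<forall>\<^sub>F r in at_top. \<mu> * (r powr \<mu> * (z r - L)) \<le> - M"
      by (rule tail_bound_of_derivative_bound[OF z_lim \<open>0 \<le> \<mu>\<close>, rotated])
    then have "E \<le> - M" by (intro tendsto_upperbound[OF tail]) auto
    with \<open>- E < M\<close> show False by simp
  qed
  moreover have "\<forall>\<^sub>F r in at_top. r powr \<mu> * (\<kappa> * z r + y r) < M \<longrightarrow> F r < 0"
    using eventually_gt_at_top[of 0] by eventually_elim (simp add: F_neg gap)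
  ultimately have freq: "\<exists>\<^sub>F r in at_top. F r < 0"
    by (rule frequently_rev_mp)
  have deriv: "\<forall>\<^sub>F r in at_top. (F has_real_derivative F' r) (at r)"
    using eventually_gt_at_top[of 0]
  proof (rule eventually_mono)
    fix r :: real assume r: "0 < r"
    have \<gamma>_deriv: "(\<gamma> has_real_derivative \<gamma>' r) (at r)"
      unfolding \<gamma>_def \<gamma>'_def
      by (rule derivative_eq_intros z_deriv r refl)+
        (use r in \<open>simp add: powr_diff field_simps\<close>)
    show "(F has_real_derivative F' r) (at r)"
      unfolding F_def F'_def
      by (rule DERIV_cong[OF DERIV_diff[OF y_deriv[OF r] DERIV_power[OF \<gamma>_deriv]]]) simp
  qed
  define c \<delta> :: real where "c = (if \<mu> = 0 then 1 else 0)" and "\<delta> = (if \<mu> = \<nu> then 1 else 0)"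
  have c_lim: "((\<lambda>r::real. r powr - \<mu>) \<longlongrightarrow> c) at_top"
    using tendsto_powr_at_top_nonpos[of "- \<mu>"] \<open>0 \<le> \<mu>\<close> by (simp add: c_def)
  have \<delta>_lim: "((\<lambda>r::real. r powr (\<mu> - \<nu>)) \<longlongrightarrow> \<delta>) at_top"
    using tendsto_powr_at_top_nonpos[of "\<mu> - \<nu>"] \<open>\<mu> \<le> \<nu>\<close> by (simp add: \<delta>_def)
  have \<gamma>_lim: "(\<gamma> \<longlongrightarrow> M * c - \<kappa> * L) at_top"
    unfolding \<gamma>_def by (intro tendsto_intros z_lim c_lim)
  have nu_lim: "((\<lambda>r::real. r powr - \<nu>) \<longlongrightarrow> 0) at_top"
    using nu_pos by (intro tendsto_neg_powr filterlim_ident) auto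
  \<comment> \<open>On \<open>y = \<gamma>\<close> one has
    \<open>\<kappa> * z + y = M * r powr - \<mu>\<close>. Substituting this in \<open>F'\<close> and
    factoring out \<open>- (r powr (\<nu> - \<mu>) / r)\<close> leaves exactly this
    expression.\<close>
  have bracket: "((\<lambda>r. M + r powr \<mu> * g r + a * (r powr (\<mu> - \<nu>) * \<gamma> r ^ k)
      - real k * (\<mu> + \<kappa>) * M * (r powr - \<nu> * \<gamma> r ^ (k - 1))) \<longlongrightarrow>
      M + G + a * (\<delta> * (M * c - \<kappa> * L) ^ k)
      - real k * (\<mu> + \<kappa>) * M * (0 * (M * c - \<kappa> * L) ^ (k - 1))) at_top"
    by (intro tendsto_intros g_lim \<delta>_lim nu_lim \<gamma>_lim)
  \<comment> \<open>The limit equals \<open>M + E\<close>. If \<open>\<mu> = \<nu>\<close>, then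
    \<open>\<mu> > 0\<close> and \<open>c = 0\<close>, so the power reduces to the
    \<open>(- \<kappa> * L) ^ k\<close> in \<open>E\<close>; otherwise
    \<open>\<delta> = 0\<close>.\<close>
  have bracket_pos: "0 < M + G + a * (\<delta> * (M * c - \<kappa> * L) ^ k)
      - real k * (\<mu> + \<kappa>) * M * (0 * (M * c - \<kappa> * L) ^ (k - 1))"
    using \<open>- E < M\<close> nu_pos by (auto simp: E c_def \<delta>_def)
  have inward: "\<forall>\<^sub>F r in at_top. F r = 0 \<longrightarrow> F' r < 0"
    using order_tendstoD(1)[OF bracket bracket_pos] eventually_gt_at_top[of 0]
  proof eventually_elim
    case (elim r)
    show ?case
    proof
      assume "F r = 0"
      then have y: "y r = \<gamma> r" by (rule F_zero)
      have p: "\<kappa> * z r + \<gamma> r = M * r powr - \<mu>" by (simp add: \<gamma>_def)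
      define b where "b = M + r powr \<mu> * g r + a * (r powr (\<mu> - \<nu>) * \<gamma> r ^ k)
        - real k * (\<mu> + \<kappa>) * M * (r powr - \<nu> * \<gamma> r ^ (k - 1))"
      have "F' r = - (r powr (\<nu> - \<mu>) / r) * b"
        unfolding F'_def \<gamma>'_def y p b_def using elim
        by (simp add: powr_diff powr_minus field_simps)
      moreover have "b > 0" using elim(1) unfolding b_def .
      ultimately show "F' r < 0" using elim by simp
    qed
  qed
  have "\<forall>\<^sub>F r in at_top. F r < 0"
    by (rule eventually_negative_if_frequently_negative[OF freq deriv inward])
  then show ?thesis
    using eventually_gt_at_top[of 0] by eventually_elim (simp add: F_neg gap)
qed

text \<open>For odd \<open>k\<close>, \<open>y ^ k\<close> changes sign with \<open>y\<close>, so
  every term of both equations does.\<close>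

lemma relaxing_system_minus:
  "relaxing_system k \<kappa> \<nu> a (- L) (\<lambda>r. - z r) (\<lambda>r. - y r) (\<lambda>r. - g r)"
proof
  fix r :: real assume r: "0 < r"
  show "((\<lambda>r. - z r) has_real_derivative (\<kappa> * - z r + - y r) / r) (at r)"
    using DERIV_minus[OF z_deriv[OF r]] by (simp add: minus_divide_left)
  show "((\<lambda>r. (- y r) ^ k) has_real_derivative
      - (a * (- y r) ^ k + r powr \<nu> * (\<kappa> * - z r + - y r + - g r)) / r) (at r)"
    unfolding power_minus_odd[OF odd_k]
    by (rule DERIV_cong[OF DERIV_minus[OF y_deriv[OF r]]]) (use r in \<open>simp add: field_simps\<close>)
qed (use odd_k nu_pos tendsto_minus[OF z_lim] in auto)

text \<open>The upper bound for the system and for its negation squeeze the slope. The premise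
  \<open>tail\<close> is trivial for \<open>\<mu> = 0\<close>, where it forces \<open>E = 0\<close>;
  for \<open>\<mu> > 0\<close> it is the second-order expansion of \<open>z\<close>.\<close>

lemma slope_tendsto:
  fixes \<mu> G E :: real
  assumes "0 \<le> \<mu>" "\<mu> \<le> \<nu>"
    and g_lim: "((\<lambda>r. r powr \<mu> * g r) \<longlongrightarrow> G) at_top"
    and E: "E = G + (if \<mu> = \<nu> then a * (- \<kappa> * L) ^ k else 0)"
    and tail: "((\<lambda>r. \<mu> * (r powr \<mu> * (z r - L))) \<longlongrightarrow> E) at_top"
  shows "((\<lambda>r. r powr \<mu> * (\<kappa> * z r + y r)) \<longlongrightarrow> - E) at_top"
proof (rule order_tendstoI)
  fix M assume "- E < M"
  with assms show "\<forall>\<^sub>F r in at_top. r powr \<mu> * (\<kappa> * z r + y r) < M"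
    by (rule slope_eventually_less)
next
  fix M assume "M < - E"
  interpret neg: relaxing_system k \<kappa> \<nu> a "- L" "\<lambda>r. - z r" "\<lambda>r. - y r" "\<lambda>r. - g r"
    by (rule relaxing_system_minus)
  have "\<forall>\<^sub>F r in at_top. r powr \<mu> * (\<kappa> * - z r + - y r) < - M"
  proof (rule neg.slope_eventually_less[OF assms(1,2)])
    show "((\<lambda>r. r powr \<mu> * - g r) \<longlongrightarrow> - G) at_top"
      using tendsto_minus[OF g_lim] by simp
    show "- E = - G + (if \<mu> = \<nu> then a * (- \<kappa> * - L) ^ k else 0)"
      using odd_k by (simp add: E power_mult_distrib)
    show "((\<lambda>r. \<mu> * (r powr \<mu> * (- z r - - L))) \<longlongrightarrow> - E) at_top"
      using tendsto_minus[OF tail] by (simp add: algebra_simps)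
    show "- (- E) < - M" using \<open>M < - E\<close> by simp
  qed
  then show "\<forall>\<^sub>F r in at_top. M < r powr \<mu> * (\<kappa> * z r + y r)"
    by eventually_elim (simp add: algebra_simps)
qed

lemma y_tendsto:
  assumes "(g \<longlongrightarrow> 0) at_top"
  shows "(y \<longlongrightarrow> - \<kappa> * L) at_top"
proof -
  \<comment> \<open>Only eventual equality is available, since \<open>0 powr 0 = 0\<close>.\<close>
  have one: "\<forall>\<^sub>F r in at_top. r powr 0 * f r = f r" for f :: "real \<Rightarrow> real"
    using eventually_gt_at_top[of 0] by eventually_elim simp
  have "((\<lambda>r. r powr 0 * g r) \<longlongrightarrow> 0) at_top"
    using assms by (simp only: tendsto_cong[OF one])
  then have "((\<lambda>r. r powr 0 * (\<kappa> * z r + y r)) \<longlongrightarrow> - 0) at_top"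
    using nu_pos by (intro slope_tendsto[of 0 0]) auto
  then have "((\<lambda>r. \<kappa> * z r + y r) \<longlongrightarrow> 0) at_top"
    by (simp only: tendsto_cong[OF one] minus_zero)
  from tendsto_diff[OF this tendsto_mult[OF tendsto_const z_lim], of \<kappa>]
  show ?thesis by simp
qed

text \<open>The derivative of \<open>z + r\<^sup>-\<^sup>\<nu> y\<^sup>k\<close> involves no difference \<open>\<kappa> z + y\<close>, whose decay rate is not
  yet known.\<close>

lemma z_expansion:
  assumes "0 < \<mu>" "\<mu> \<le> \<nu>"
    and g_lim: "((\<lambda>r. r powr \<mu> * g r) \<longlongrightarrow> G) at_top"
    and y_lim: "(y \<longlongrightarrow> - \<kappa> * L) at_top"
  shows "((\<lambda>r. r powr \<mu> * (z r - L)) \<longlongrightarrow>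
    (G + (if \<mu> = \<nu> then a * (- \<kappa> * L) ^ k else 0)) / \<mu>) at_top"
proof -
  define Y where "Y = (- \<kappa> * L) ^ k"
  define \<delta> where "\<delta> = (if \<mu> = \<nu> then 1 else 0 :: real)"
  define u where "u = (\<lambda>r. z r + r powr - \<nu> * y r ^ k)"
  define u' where "u' = (\<lambda>r. - (g r + (a + \<nu>) * (r powr - \<nu> * y r ^ k)) / r)"
  have Y_lim: "((\<lambda>r. y r ^ k) \<longlongrightarrow> Y) at_top"
    unfolding Y_def by (intro tendsto_intros y_lim)
  have nu_lim: "((\<lambda>r::real. r powr - \<nu>) \<longlongrightarrow> 0) at_top"
    using nu_pos by (intro tendsto_neg_powr filterlim_ident) auto
  have \<delta>_lim: "((\<lambda>r::real. r powr (\<mu> - \<nu>)) \<longlongrightarrow> \<delta>) at_top"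
    using tendsto_powr_at_top_nonpos[of "\<mu> - \<nu>"] \<open>\<mu> \<le> \<nu>\<close> by (simp add: \<delta>_def)
  have "(u \<longlongrightarrow> L + 0 * Y) at_top"
    unfolding u_def by (intro tendsto_intros z_lim nu_lim Y_lim)
  then have u_lim: "(u \<longlongrightarrow> L) at_top" by simp
  have u_deriv: "\<forall>\<^sub>F r in at_top. (u has_real_derivative u' r) (at r)"
    using eventually_gt_at_top[of 0]
  proof (rule eventually_mono)
    fix r :: real assume r: "0 < r"
    show "(u has_real_derivative u' r) (at r)"
      unfolding u_def
      by (rule derivative_eq_intros z_deriv y_deriv r refl)+
        (use r in \<open>simp add: u'_def powr_diff powr_minus field_simps\<close>)
  qed
  have "((\<lambda>r. - (r powr \<mu> * g r + (a + \<nu>) * (r powr (\<mu> - \<nu>) * y r ^ k))) \<longlongrightarrow>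
      - (G + (a + \<nu>) * (\<delta> * Y))) at_top"
    by (intro tendsto_intros g_lim \<delta>_lim Y_lim)
  moreover have "\<forall>\<^sub>F r in at_top. - (r powr \<mu> * g r + (a + \<nu>) * (r powr (\<mu> - \<nu>) * y r ^ k)) =
      r powr (\<mu> + 1) * u' r"
    using eventually_gt_at_top[of 0]
    by eventually_elim (simp add: u'_def powr_diff powr_minus powr_add field_simps)
  ultimately have "((\<lambda>r. r powr (\<mu> + 1) * u' r) \<longlongrightarrow> - (G + (a + \<nu>) * (\<delta> * Y))) at_top"
    by (rule Lim_transform_eventually)
  from tail_expansion_of_derivative_limit[OF u_lim \<open>0 < \<mu>\<close> u_deriv this]
  have "((\<lambda>r. r powr \<mu> * (u r - L) - r powr (\<mu> - \<nu>) * y r ^ k) \<longlongrightarrow>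
      - (- (G + (a + \<nu>) * (\<delta> * Y))) / \<mu> - \<delta> * Y) at_top"
    by (intro tendsto_intros \<delta>_lim Y_lim)
  moreover have "\<forall>\<^sub>F r in at_top. r powr \<mu> * (u r - L) - r powr (\<mu> - \<nu>) * y r ^ k =
      r powr \<mu> * (z r - L)"
    using eventually_gt_at_top[of 0]
    by eventually_elim (simp add: u_def powr_diff powr_minus field_simps)
  \<comment> \<open>Returning from \<open>u\<close> to \<open>z\<close> costs
    \<open>\<delta> * Y\<close>. When \<open>\<mu> = \<nu>\<close> this cancels the
    \<open>\<nu>\<close> in \<open>a + \<nu>\<close>, leaving the coefficient
    \<open>a\<close>.\<close>
  moreover have "- (- (G + (a + \<nu>) * (\<delta> * Y))) / \<mu> - \<delta> * Y =
      (G + (if \<mu> = \<nu> then a * (- \<kappa> * L) ^ k else 0)) / \<mu>"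
    using \<open>0 < \<mu>\<close> by (auto simp: \<delta>_def Y_def field_simps)
  ultimately show ?thesis by (auto dest: Lim_transform_eventually)
qed

text \<open>Only the product \<open>D * C\<close> matters for the limits; the splitting matches the
  normalisation of \<open>A\<close>, \<open>B\<close> by powers of \<open>2k/(k+1)\<close>. The
  factor \<open>\<kappa> + \<mu>\<close> arises because \<open>y\<close> is the slope term,
  contributing \<open>- \<mu> * D * C\<close>, minus \<open>\<kappa> * z\<close>, contributing
  \<open>- \<kappa> * D * C\<close>.\<close>

lemma joint_expansion:
  assumes "0 < \<mu>" "\<mu> \<le> \<nu>" and "C \<noteq> 0"
    and g_lim: "((\<lambda>r. r powr \<mu> * g r) \<longlongrightarrow> G) at_top"
    and y_lim: "(y \<longlongrightarrow> - \<kappa> * L) at_top"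
    and "0 < \<kappa>"
    and D: "D * C = (G + (if \<mu> = \<nu> then a * (- \<kappa> * L) ^ k else 0)) / \<mu>"
  shows "\<exists>e \<in> o[at_top](\<lambda>_. 1). \<forall>\<^sub>F r in at_top. z r = L + (D + e r) * C * r powr - \<mu>"
    and "\<exists>e \<in> o[at_top](\<lambda>_. 1). \<forall>\<^sub>F r in at_top.
      y r = - (\<kappa> * L + (\<kappa> + \<mu>) * (D + e r) * C * r powr - \<mu>)"
proof -
  have z_exp: "((\<lambda>r. r powr \<mu> * (z r - L)) \<longlongrightarrow> D * C) at_top"
    unfolding D by (rule z_expansion[OF assms(1,2) g_lim y_lim])
  have slope: "((\<lambda>r. r powr \<mu> * (\<kappa> * z r + y r)) \<longlongrightarrow> - (\<mu> * (D * C))) at_top"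
    using assms(1,2) by (intro slope_tendsto[OF _ _ g_lim] tendsto_intros z_exp) (auto simp: D)
  define e1 where "e1 = (\<lambda>r. r powr \<mu> * (z r - L) / C - D)"
  have "(e1 \<longlongrightarrow> D * C / C - D) at_top"
    unfolding e1_def by (intro tendsto_intros z_exp \<open>C \<noteq> 0\<close>)
  then have "e1 \<in> o[at_top](\<lambda>_. 1)" using \<open>C \<noteq> 0\<close> by (auto intro: smalloI_tendsto)
  moreover have "\<forall>\<^sub>F r in at_top. z r = L + (D + e1 r) * C * r powr - \<mu>"
    using eventually_gt_at_top[of 0]
    by eventually_elim (use \<open>C \<noteq> 0\<close> in \<open>simp add: e1_def powr_minus field_simps\<close>)
  ultimately show "\<exists>e \<in> o[at_top](\<lambda>_. 1). \<forall>\<^sub>F r in at_top. z r = L + (D + e r) * C * r powr - \<mu>"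
    by blast
  define K where "K = (\<kappa> + \<mu>) * C"
  have "K \<noteq> 0" using \<open>C \<noteq> 0\<close> \<open>0 < \<kappa>\<close> \<open>0 < \<mu>\<close> by (simp add: K_def)
  define e2 where
    "e2 = (\<lambda>r. (\<kappa> * (r powr \<mu> * (z r - L)) - r powr \<mu> * (\<kappa> * z r + y r)) / K - D)"
  have "(e2 \<longlongrightarrow> (\<kappa> * (D * C) - - (\<mu> * (D * C))) / K - D) at_top"
    unfolding e2_def by (intro tendsto_intros z_exp slope \<open>K \<noteq> 0\<close>)
  moreover have "\<kappa> * (D * C) - - (\<mu> * (D * C)) = D * K" by (simp add: K_def algebra_simps)
  ultimately have "e2 \<in> o[at_top](\<lambda>_. 1)" using \<open>K \<noteq> 0\<close> by (auto intro: smalloI_tendsto)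
  moreover have "\<forall>\<^sub>F r in at_top. y r = - (\<kappa> * L + (\<kappa> + \<mu>) * (D + e2 r) * C * r powr - \<mu>)"
    using eventually_gt_at_top[of 0]
  proof eventually_elim
    case (elim r)
    have "(\<kappa> + \<mu>) * (D + e2 r) * C = K * (D + e2 r)" by (simp add: K_def)
    also have "\<dots> = - (r powr \<mu> * (\<kappa> * L + y r))"
      using \<open>K \<noteq> 0\<close> by (simp add: e2_def field_simps)
    finally show ?case using elim by (simp add: powr_minus field_simps)
  qed
  ultimately show "\<exists>e \<in> o[at_top](\<lambda>_. 1). \<forall>\<^sub>F r in at_top.
      y r = - (\<kappa> * L + (\<kappa> + \<mu>) * (D + e r) * C * r powr - \<mu>)" by blast
qed

end

section \<open>From the differential equation to the relaxing system\<close>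

text \<open>Up to the factor \<open>r powr (- a)\<close>, \<open>y ^ k\<close> is the function
  \<open>\<Phi>\<close> assumed continuously differentiable, so \<open>v'\<close> itself is never
  differentiated.\<close>

lemma is_solution_relaxing_system:
  fixes n k :: nat and q \<kappa> L :: real and v :: "real \<Rightarrow> real"
  assumes "1 \<le> k" "k \<le> n" "odd k" "0 < \<kappa>"
    and sol: "is_solution n k q \<kappa> v"
    and lim: "((\<lambda>r. r powr \<kappa> * v r) \<longlongrightarrow> L) at_top"
  shows "relaxing_system k \<kappa> (nu k \<kappa>) (real n - 2 * real k - real k * \<kappa>) L
    (\<lambda>r. r powr \<kappa> * v r) (\<lambda>r. r powr (\<kappa> + 1) * deriv v r)
    (\<lambda>r. inverse (c_nk n k) * r powr (- \<kappa> * (q - 1)) *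
      (\<bar>r powr \<kappa> * v r\<bar> powr (q - 1) * (r powr \<kappa> * v r)))"
proof
  define \<Phi> where "\<Phi> = (\<lambda>s. s ^ (n - k) * deriv v s ^ k)"
  define a where "a = real n - 2 * real k - real k * \<kappa>"
  have v_deriv: "(v has_real_derivative deriv v r) (at r)" if "0 < r" for r
    using sol that C1_differentiable_on_eq[of v] unfolding is_solution_def
    by (auto intro!: DERIV_deriv_iff_real_differentiable[THEN iffD2])
  have Phi_deriv: "(\<Phi> has_real_derivative deriv \<Phi> r) (at r)" if "0 < r" for r
    using sol that C1_differentiable_on_eq[of \<Phi>] unfolding is_solution_def \<Phi>_def
    by (auto intro!: DERIV_deriv_iff_real_differentiable[THEN iffD2])
  have Phi_eq: "deriv \<Phi> r = - (r ^ (n - 1) * (r * deriv v r + \<kappa> * v r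
            + inverse (c_nk n k) * \<bar>v r\<bar> powr (q - 1) * v r))" if "0 < r" for r
  proof -
    have "deriv \<Phi> r + r ^ (n - 1) * (r * deriv v r + \<kappa> * v r
            + inverse (c_nk n k) * \<bar>v r\<bar> powr (q - 1) * v r) = 0"
      using sol that unfolding is_solution_def \<Phi>_def by blast
    then show ?thesis by linarith
  qed
  have y_Phi: "(r powr (\<kappa> + 1) * deriv v r) ^ k = r powr (- a) * \<Phi> r" if "0 < r" for r
  proof -
    have "r powr (- a) = r powr (real k * (\<kappa> + 1)) / r powr (real (n - k))"
      using \<open>k \<le> n\<close> by (simp add: a_def algebra_simps flip: powr_diff)
    moreover have "(r powr (\<kappa> + 1)) ^ k = r powr (real k * (\<kappa> + 1))"
      using that by (simp add: powr_power)
    ultimately show ?thesis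
      using that by (simp add: \<Phi>_def power_mult_distrib powr_realpow)
  qed
  fix r :: real assume r: "0 < r"
  define y z where "y = r powr (\<kappa> + 1) * deriv v r" and "z = r powr \<kappa> * v r"
  define g where "g = inverse (c_nk n k) * r powr (- \<kappa> * (q - 1)) * (\<bar>z\<bar> powr (q - 1) * z)"
  show "((\<lambda>r. r powr \<kappa> * v r) has_real_derivative
      (\<kappa> * (r powr \<kappa> * v r) + r powr (\<kappa> + 1) * deriv v r) / r) (at r)"
    by (rule derivative_eq_intros v_deriv r refl)+
      (use r in \<open>simp add: powr_diff powr_add field_simps\<close>)
  have "r * deriv v r + \<kappa> * v r + inverse (c_nk n k) * \<bar>v r\<bar> powr (q - 1) * v r =
      r powr (- \<kappa>) * (\<kappa> * z + y + g)"
  proof -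
    have "\<bar>z\<bar> powr (q - 1) = r powr (\<kappa> * (q - 1)) * \<bar>v r\<bar> powr (q - 1)"
      by (simp add: z_def abs_mult powr_mult powr_powr)
    then have "g = inverse (c_nk n k) * \<bar>v r\<bar> powr (q - 1) * z"
      using r by (simp add: g_def powr_minus)
    then show ?thesis
      using r by (simp add: y_def z_def powr_add powr_minus field_simps)
  qed
  then have Phi': "deriv \<Phi> r = - (r powr (real n - 1) * (r powr (- \<kappa>) * (\<kappa> * z + y + g)))"
    using Phi_eq[OF r] r \<open>1 \<le> k\<close> \<open>k \<le> n\<close> by (simp flip: powr_realpow)
  have "((\<lambda>r. r powr (- a) * \<Phi> r) has_real_derivative
      - a * r powr (- a - 1) * \<Phi> r + deriv \<Phi> r * r powr (- a)) (at r)"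
    by (rule derivative_eq_intros Phi_deriv r refl)+ simp
  \<comment> \<open>The identity holds for positive arguments only, which suffices near
    \<open>r\<close>.\<close>
  moreover have "\<forall>\<^sub>F s in nhds r. s powr (- a) * \<Phi> s = (s powr (\<kappa> + 1) * deriv v s) ^ k"
    using eventually_nhds_in_open[of "{0<..}" r] r by (auto elim!: eventually_mono simp: y_Phi)
  ultimately have "((\<lambda>r. (r powr (\<kappa> + 1) * deriv v r) ^ k) has_real_derivative
      - a * r powr (- a - 1) * \<Phi> r + deriv \<Phi> r * r powr (- a)) (at r)"
    by (simp add: DERIV_cong_ev)
  moreover have "- a * r powr (- a - 1) * \<Phi> r + deriv \<Phi> r * r powr (- a) =
      - (a * y ^ k + r powr nu k \<kappa> * (\<kappa> * z + y + g)) / r"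
  proof -
    \<comment> \<open>The exponents add up to \<open>(k - 1) * \<kappa> + 2 * k - 1\<close>; this is
      where the relaxation rate \<open>\<nu>\<close> comes from.\<close>
    have "r powr (real n - 1) * r powr (- \<kappa>) * r powr (- a) = r powr (nu k \<kappa> - 1)"
      by (simp add: nu_def a_def algebra_simps flip: powr_add)
    then have "r powr (real n - 1) * r powr (- \<kappa>) * r powr (- a) = r powr nu k \<kappa> / r"
      using r by (simp add: powr_diff)
    moreover have "deriv \<Phi> r * r powr (- a) =
        - (r powr (real n - 1) * r powr (- \<kappa>) * r powr (- a)) * (\<kappa> * z + y + g)"
      unfolding Phi' by algebra
    ultimately have "deriv \<Phi> r * r powr (- a) = - (r powr nu k \<kappa> / r) * (\<kappa> * z + y + g)"
      by (simp only:)
    moreover have "r powr (- a - 1) * \<Phi> r = y ^ k / r"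
      using r y_Phi[OF r] by (simp add: y_def powr_diff)
    ultimately show ?thesis
      by (simp add: mult.assoc add_divide_distrib diff_divide_distrib)
  qed
  ultimately show "((\<lambda>r. (r powr (\<kappa> + 1) * deriv v r) ^ k) has_real_derivative
      - ((real n - 2 * real k - real k * \<kappa>) * (r powr (\<kappa> + 1) * deriv v r) ^ k
        + r powr nu k \<kappa> * (\<kappa> * (r powr \<kappa> * v r) + r powr (\<kappa> + 1) * deriv v r
          + inverse (c_nk n k) * r powr (- \<kappa> * (q - 1)) *
            (\<bar>r powr \<kappa> * v r\<bar> powr (q - 1) * (r powr \<kappa> * v r)))) / r) (at r)"
    by (simp only: a_def y_def z_def g_def)
qed (use assms in \<open>auto simp: nu_def intro!: add_nonneg_pos\<close>)

section \<open>The three regimes of the expansion\<close>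

theorem proposition5p4:
  fixes n k :: nat and q \<kappa> L :: real and v :: "real \<Rightarrow> real"
  assumes "n > 2" and "1 \<le> k" and "k \<le> n" and "odd k"
    and "q > real k" and "\<kappa> > 0"
    and "is_solution n k q \<kappa> v"
    and "((\<lambda>r. r powr \<kappa> * v r) \<longlongrightarrow> L) at_top" and "L > 0"
  defines "A \<equiv> coeff_A n k \<kappa> L" and "B \<equiv> coeff_B n k q \<kappa> L" and "\<nu> \<equiv> nu k \<kappa>"
    and "P \<equiv> (2 * real k / (real k + 1)) powr ((real k + 1) * (\<kappa> + 2) / 2)"
    and "Q \<equiv> (2 * real k / (real k + 1)) powr ((real k + 1) * \<kappa> * q / (2 * real k))"
  shows "((\<lambda>r. r powr (\<kappa> + 1) * deriv v r) \<longlongrightarrow> - \<kappa> * L) at_top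
    \<and> ((q - real k) * \<kappa> > 2 * real k \<longrightarrow>
         (\<exists>e \<in> o[at_top](\<lambda>_. 1). \<forall>\<^sub>F r in at_top.
            v r = r powr (- \<kappa>) * (L + (A + e r) * P * r powr (- \<nu>))))
    \<and> ((q - real k) * \<kappa> = 2 * real k \<longrightarrow>
         (\<exists>e \<in> o[at_top](\<lambda>_. 1). \<forall>\<^sub>F r in at_top.
            v r = r powr (- \<kappa>) * (L + (A + B + e r) * Q * r powr (- \<kappa> * (q - 1)))))
    \<and> ((q - real k) * \<kappa> < 2 * real k \<longrightarrow>
         (\<exists>e \<in> o[at_top](\<lambda>_. 1). \<forall>\<^sub>F r in at_top.
            v r = r powr (- \<kappa>) * (L + (B + e r) * Q * r powr (- \<kappa> * (q - 1)))))
    \<and> ((q - real k) * \<kappa> > 2 * real k \<longrightarrow>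
         (\<exists>e \<in> o[at_top](\<lambda>_. 1). \<forall>\<^sub>F r in at_top.
            deriv v r = - (r powr (- \<kappa> - 1))
              * (\<kappa> * L + (\<kappa> + \<nu>) * (A + e r) * P * r powr (- \<nu>))))
    \<and> ((q - real k) * \<kappa> = 2 * real k \<longrightarrow>
         (\<exists>e \<in> o[at_top](\<lambda>_. 1). \<forall>\<^sub>F r in at_top.
            deriv v r = - (r powr (- \<kappa> - 1))
              * (\<kappa> * L + \<kappa> * q * (A + B + e r) * Q * r powr (- \<kappa> * (q - 1)))))
    \<and> ((q - real k) * \<kappa> < 2 * real k \<longrightarrow>
         (\<exists>e \<in> o[at_top](\<lambda>_. 1). \<forall>\<^sub>F r in at_top.
            deriv v r = - (r powr (- \<kappa> - 1))
              * (\<kappa> * L + \<kappa> * q * (B + e r) * Q * r powr (- \<kappa> * (q - 1)))))"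
proof -
  define z y where "z = (\<lambda>r. r powr \<kappa> * v r)" and "y = (\<lambda>r. r powr (\<kappa> + 1) * deriv v r)"
  define g where "g = (\<lambda>r. inverse (c_nk n k) * r powr (- \<kappa> * (q - 1)) * (\<bar>z r\<bar> powr (q - 1) * z r))"
  define a where "a = real n - 2 * real k - real k * \<kappa>"
  define H where "H = inverse (c_nk n k) * L powr q"
  interpret relaxing_system k \<kappa> \<nu> a L z y g
    unfolding z_def y_def g_def a_def \<nu>_def
    by (rule is_solution_relaxing_system) (use assms in auto)
  have k: "real k \<ge> 1" "real k < q" using assms by auto
  then have "1 < q" by linarith
  have \<nu>: "\<nu> = (real k - 1) * \<kappa> + 2 * real k" by (simp add: \<nu>_def nu_def)
  \<comment> \<open>The last factor tends to \<open>H\<close>, so \<open>r powr \<mu> * g r\<close>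
    tends to 0 for \<open>\<mu>\<close> below \<open>\<kappa> * (q - 1)\<close> and to
    \<open>H\<close> at equality.\<close>
  have g_eq: "r powr \<mu> * g r =
      r powr (\<mu> - \<kappa> * (q - 1)) * (inverse (c_nk n k) * (\<bar>z r\<bar> powr (q - 1) * z r))" for r \<mu>
  proof -
    have "r powr (\<mu> - \<kappa> * (q - 1)) = r powr \<mu> * r powr (- \<kappa> * (q - 1))"
      by (simp flip: powr_add)
    then show ?thesis by (simp add: g_def)
  qed
  have "((\<lambda>r. inverse (c_nk n k) * (\<bar>z r\<bar> powr (q - 1) * z r)) \<longlongrightarrow>
      inverse (c_nk n k) * (\<bar>L\<bar> powr (q - 1) * L)) at_top"
    using \<open>L > 0\<close> by (intro tendsto_intros z_lim) auto
  moreover have "\<bar>L\<bar> powr (q - 1) * L = L powr q"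
    using \<open>L > 0\<close> by (simp add: powr_diff)
  ultimately have zq_lim: "((\<lambda>r. inverse (c_nk n k) * (\<bar>z r\<bar> powr (q - 1) * z r)) \<longlongrightarrow> H) at_top"
    by (simp add: H_def)
  have g_sub: "((\<lambda>r. r powr \<mu> * g r) \<longlongrightarrow> 0) at_top" if "\<mu> < \<kappa> * (q - 1)" for \<mu>
  proof -
    have "((\<lambda>r::real. r powr (\<mu> - \<kappa> * (q - 1))) \<longlongrightarrow> 0) at_top"
      using that by (intro tendsto_neg_powr filterlim_ident) auto
    from tendsto_mult[OF this zq_lim] show ?thesis unfolding g_eq by simp
  qed
  have g_crit: "((\<lambda>r. r powr (\<kappa> * (q - 1)) * g r) \<longlongrightarrow> H) at_top"
  proof (rule Lim_transform_eventually[OF zq_lim])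
    show "\<forall>\<^sub>F r in at_top. inverse (c_nk n k) * (\<bar>z r\<bar> powr (q - 1) * z r) =
        r powr (\<kappa> * (q - 1)) * g r"
      using eventually_gt_at_top[of 0] by eventually_elim (simp add: g_eq)
  qed
  have "((\<lambda>r. r powr 0 * g r) \<longlongrightarrow> 0) at_top"
    using \<open>1 < q\<close> \<open>\<kappa> > 0\<close> by (intro g_sub) simp
  moreover have "\<forall>\<^sub>F r in at_top. r powr 0 * g r = g r"
    using eventually_gt_at_top[of 0] by eventually_elim simp
  ultimately have "(g \<longlongrightarrow> 0) at_top" by (rule Lim_transform_eventually)
  then have y_lim: "(y \<longlongrightarrow> - \<kappa> * L) at_top" by (rule y_tendsto)
  have v_exp: "\<exists>e \<in> o[at_top](\<lambda>_. 1). \<forall>\<^sub>F r in at_top.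
        v r = r powr (- \<kappa>) * (L + (D + e r) * C * r powr (- \<mu>))"
    and v'_exp: "\<exists>e \<in> o[at_top](\<lambda>_. 1). \<forall>\<^sub>F r in at_top.
        deriv v r = - (r powr (- \<kappa> - 1)) * (\<kappa> * L + (\<kappa> + \<mu>) * (D + e r) * C * r powr (- \<mu>))"
    if "0 < \<mu>" "\<mu> \<le> \<nu>" "C > 0" "((\<lambda>r. r powr \<mu> * g r) \<longlongrightarrow> G) at_top"
      "D * C = (G + (if \<mu> = \<nu> then a * (- \<kappa> * L) ^ k else 0)) / \<mu>" for \<mu> C D G
  proof -
    have "C \<noteq> 0" using that by simp
    note E = joint_expansion[OF that(1,2) \<open>C \<noteq> 0\<close> that(4) y_lim \<open>\<kappa> > 0\<close> that(5)]
    obtain e where e: "e \<in> o[at_top](\<lambda>_. 1)"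
        "\<forall>\<^sub>F r in at_top. z r = L + (D + e r) * C * r powr (- \<mu>)"
      using E(1) by blast
    have "\<forall>\<^sub>F r in at_top. v r = r powr (- \<kappa>) * (L + (D + e r) * C * r powr (- \<mu>))"
      using e(2) eventually_gt_at_top[of 0]
    proof eventually_elim
      case (elim r)
      then show ?case unfolding elim(1)[symmetric] by (simp add: z_def powr_minus)
    qed
    with e(1) show "\<exists>e \<in> o[at_top](\<lambda>_. 1). \<forall>\<^sub>F r in at_top.
        v r = r powr (- \<kappa>) * (L + (D + e r) * C * r powr (- \<mu>))" by blast
    obtain e where e: "e \<in> o[at_top](\<lambda>_. 1)"
        "\<forall>\<^sub>F r in at_top. y r = - (\<kappa> * L + (\<kappa> + \<mu>) * (D + e r) * C * r powr (- \<mu>))"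
      using E(2) by blast
    have "\<forall>\<^sub>F r in at_top. deriv v r =
        - (r powr (- \<kappa> - 1)) * (\<kappa> * L + (\<kappa> + \<mu>) * (D + e r) * C * r powr (- \<mu>))"
      using e(2) eventually_gt_at_top[of 0]
    proof eventually_elim
      case (elim r)
      then have "\<kappa> * L + (\<kappa> + \<mu>) * (D + e r) * C * r powr (- \<mu>) = - y r" by simp
      then show ?case using elim(2) by (simp add: y_def powr_diff powr_add powr_minus)
    qed
    with e(1) show "\<exists>e \<in> o[at_top](\<lambda>_. 1). \<forall>\<^sub>F r in at_top. deriv v r =
        - (r powr (- \<kappa> - 1)) * (\<kappa> * L + (\<kappa> + \<mu>) * (D + e r) * C * r powr (- \<mu>))" by blast
  qed
  \<comment> \<open>The sign of this difference decides which of \<open>\<nu>\<close> and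
    \<open>\<kappa> * (q - 1)\<close> is smaller and so serves as \<open>\<mu>\<close>.\<close>
  have gap: "\<kappa> * (q - 1) - \<nu> = (q - real k) * \<kappa> - 2 * real k"
    by (simp add: \<nu> algebra_simps)
  have \<kappa>q: "\<kappa> * q = \<kappa> + \<kappa> * (q - 1)" by (simp add: algebra_simps)
  have recip: "(x / y) powr s * (y / x) powr s = 1" if "0 < x" "0 < y" for x y s :: real
    using that by (simp flip: powr_mult)
  have PQ_pos: "P > 0" "Q > 0" using k by (auto simp: P_def Q_def)
  \<comment> \<open>The powers of \<open>2k/(k+1)\<close> and of its reciprocal cancel, and the sign
    of \<open>- a\<close> is absorbed by the odd power of \<open>- \<kappa> * L\<close>.\<close>
  have AP: "A * P = a * (- \<kappa> * L) ^ k / \<nu>"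
  proof -
    have "A * P = (real k * \<kappa> - (real n - 2 * real k)) * (\<kappa> * L) ^ k / \<nu> *
        (((real k + 1) / (2 * real k)) powr ((real k + 1) * (\<kappa> + 2) / 2) *
         (2 * real k / (real k + 1)) powr ((real k + 1) * (\<kappa> + 2) / 2))"
      by (simp add: A_def P_def coeff_A_def \<nu>_def)
    also have "\<dots> = - a * (\<kappa> * L) ^ k / \<nu>"
      using k by (subst recip) (auto simp: a_def algebra_simps)
    finally show ?thesis using \<open>odd k\<close> by simp
  qed
  have BQ: "B * Q = H / (\<kappa> * (q - 1))"
  proof -
    have "B * Q = L powr q / (\<kappa> * (q - 1) * c_nk n k) *
        (((real k + 1) / (2 * real k)) powr ((real k + 1) * \<kappa> * q / (2 * real k)) *
         (2 * real k / (real k + 1)) powr ((real k + 1) * \<kappa> * q / (2 * real k)))"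
      by (simp add: B_def Q_def coeff_B_def)
    also have "\<dots> = L powr q / (\<kappa> * (q - 1) * c_nk n k)"
      using k by (subst recip) auto
    finally show ?thesis by (simp add: H_def field_simps)
  qed
  \<comment> \<open>In the critical case both exponents coincide, so \<open>A\<close> and
    \<open>B\<close> can share the factor \<open>Q\<close>.\<close>
  have PQ: "P = Q" if "(q - real k) * \<kappa> = 2 * real k"
  proof -
    have "\<kappa> * q = real k * (\<kappa> + 2)" using that by (simp add: algebra_simps)
    then have "(real k + 1) * \<kappa> * q / (2 * real k) =
        (real k + 1) * (real k * (\<kappa> + 2)) / (2 * real k)"
      by (simp only: mult.assoc)
    also have "\<dots> = (real k + 1) * (\<kappa> + 2) / 2"
      using k by simp
    finally show ?thesis unfolding P_def Q_def by (simp only:)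
  qed
  have pos: "0 < \<kappa> * (q - 1)" using \<open>1 < q\<close> \<open>\<kappa> > 0\<close> by simp
  show ?thesis
  proof (intro conjI impI)
    show "((\<lambda>r. r powr (\<kappa> + 1) * deriv v r) \<longlongrightarrow> - \<kappa> * L) at_top"
      using y_lim unfolding y_def .
  next
    assume "(q - real k) * \<kappa> > 2 * real k"
    then have g_lim: "((\<lambda>r. r powr \<nu> * g r) \<longlongrightarrow> 0) at_top" using gap by (intro g_sub) linarith
    have D: "A * P = (0 + (if \<nu> = \<nu> then a * (- \<kappa> * L) ^ k else 0)) / \<nu>" by (simp add: AP)
    show "\<exists>e \<in> o[at_top](\<lambda>_. 1). \<forall>\<^sub>F r in at_top.
            v r = r powr (- \<kappa>) * (L + (A + e r) * P * r powr (- \<nu>))"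
      by (rule v_exp[OF nu_pos order_refl PQ_pos(1) g_lim D])
    show "\<exists>e \<in> o[at_top](\<lambda>_. 1). \<forall>\<^sub>F r in at_top.
            deriv v r = - (r powr (- \<kappa> - 1))
              * (\<kappa> * L + (\<kappa> + \<nu>) * (A + e r) * P * r powr (- \<nu>))"
      by (rule v'_exp[OF nu_pos order_refl PQ_pos(1) g_lim D])
  next
    assume crit: "(q - real k) * \<kappa> = 2 * real k"
    then have eq: "\<kappa> * (q - 1) = \<nu>" using gap by linarith
    have D: "(A + B) * Q =
        (H + (if \<kappa> * (q - 1) = \<nu> then a * (- \<kappa> * L) ^ k else 0)) / (\<kappa> * (q - 1))"
      using AP BQ PQ[OF crit] eq by (simp add: distrib_right add_divide_distrib)
    show "\<exists>e \<in> o[at_top](\<lambda>_. 1). \<forall>\<^sub>F r in at_top.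
            v r = r powr (- \<kappa>) * (L + (A + B + e r) * Q * r powr (- \<kappa> * (q - 1)))"
      using v_exp[OF pos eq_refl[OF eq] PQ_pos(2) g_crit D] by (simp only: mult_minus_left)
    show "\<exists>e \<in> o[at_top](\<lambda>_. 1). \<forall>\<^sub>F r in at_top. deriv v r = - (r powr (- \<kappa> - 1))
              * (\<kappa> * L + \<kappa> * q * (A + B + e r) * Q * r powr (- \<kappa> * (q - 1)))"
      using v'_exp[OF pos eq_refl[OF eq] PQ_pos(2) g_crit D] by (simp only: \<kappa>q mult_minus_left)
  next
    assume "(q - real k) * \<kappa> < 2 * real k"
    then have less: "\<kappa> * (q - 1) < \<nu>" using gap by linarith
    have D: "B * Q = (H + (if \<kappa> * (q - 1) = \<nu> then a * (- \<kappa> * L) ^ k else 0)) / (\<kappa> * (q - 1))"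
      using BQ less by simp
    show "\<exists>e \<in> o[at_top](\<lambda>_. 1). \<forall>\<^sub>F r in at_top.
            v r = r powr (- \<kappa>) * (L + (B + e r) * Q * r powr (- \<kappa> * (q - 1)))"
      using v_exp[OF pos less_imp_le[OF less] PQ_pos(2) g_crit D] by (simp only: mult_minus_left)
    show "\<exists>e \<in> o[at_top](\<lambda>_. 1). \<forall>\<^sub>F r in at_top. deriv v r = - (r powr (- \<kappa> - 1))
              * (\<kappa> * L + \<kappa> * q * (B + e r) * Q * r powr (- \<kappa> * (q - 1)))"
      using v'_exp[OF pos less_imp_le[OF less] PQ_pos(2) g_crit D]
      by (simp only: \<kappa>q mult_minus_left)
  qed
qed

end
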